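(* For every $a,\alpha,\beta>0$ and every $N\in\mathbb{N}$ with $\alpha\beta=\frac{1}{N+1}$, there exists a non-zero polynomial $p_N=p_N(a,\alpha,\beta)$ of degree at most $N$ such that the Gabor system $\mathcal{G}(p_N(x)e^{-ax^2},\alpha\mathbb{Z}\times\beta\mathbb{Z})$ fails to form a frame in $L^2(\mathbb{R})$. Furthermore, $p_N$ can be chosen to be even if $N$ is even and odd if $N$ is odd.
   Context: $\mathbb{N}=\{1,2,\dots\}$. Polynomials have complex coefficients. For a function $g\in L^2(\mathbb{R})$ and $\alpha,\beta>0$, the Gabor system is $\mathcal{G}(g,\alpha\mathbb{Z}\times\beta\mathbb{Z})=\{g(x-\lambda)e^{2\pi i\gamma x}:\lambda\in\alpha\mathbb{Z},\gamma\in\beta\mathbb{Z}\}$; "frame" is meant in the usual Hilbert space sense. A polynomial $p$ is even (odd) if $p(-x)=p(x)$ (respectively $p(-x)=-p(x)$) for all $x$. *)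

theory Defs
  imports "HOL-Analysis.Analysis" "HOL-Computational_Algebra.Polynomial"
begin

text \<open>
  The library has no Hilbert space type \<open>L\<^sup>2(\<real>)\<close>, so its elements are represented by functions;
  all notions below are invariant under equality almost everywhere.
\<close>

definition L2 :: "(real \<Rightarrow> complex) set" where
  "L2 = {f. f \<in> borel_measurable lebesgue \<and> integrable lebesgue (\<lambda>x. (cmod (f x))\<^sup>2)}"

definition L2_inner :: "(real \<Rightarrow> complex) \<Rightarrow> (real \<Rightarrow> complex) \<Rightarrow> complex" where
  "L2_inner f g = integral\<^sup>L lebesgue (\<lambda>x. f x * cnj (g x))"

definition L2_norm :: "(real \<Rightarrow> complex) \<Rightarrow> real" where
  "L2_norm f = sqrt (integral\<^sup>L lebesgue (\<lambda>x. (cmod (f x))\<^sup>2))"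

text \<open>
  Summability is demanded explicitly because \<^const>\<open>infsum\<close> of a non-summable family is \<open>0\<close>.
\<close>

definition L2_frame :: "'i set \<Rightarrow> ('i \<Rightarrow> real \<Rightarrow> complex) \<Rightarrow> bool" where
  "L2_frame I \<phi> \<longleftrightarrow>
     (\<forall>i\<in>I. \<phi> i \<in> L2) \<and>
     (\<exists>A B. 0 < A \<and> 0 < B \<and>
        (\<forall>f\<in>L2.
           (\<lambda>i. (cmod (L2_inner f (\<phi> i)))\<^sup>2) summable_on I \<and>
           A * (L2_norm f)\<^sup>2 \<le> (\<Sum>\<^sub>\<infinity>i\<in>I. (cmod (L2_inner f (\<phi> i)))\<^sup>2) \<and>
           (\<Sum>\<^sub>\<infinity>i\<in>I. (cmod (L2_inner f (\<phi> i)))\<^sup>2) \<le> B * (L2_norm f)\<^sup>2))"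

definition gabor_lattice :: "real \<Rightarrow> real \<Rightarrow> (real \<times> real) set" where
  "gabor_lattice \<alpha> \<beta> = range (\<lambda>k::int. \<alpha> * of_int k) \<times> range (\<lambda>l::int. \<beta> * of_int l)"

definition time_freq_shift :: "(real \<Rightarrow> complex) \<Rightarrow> real \<times> real \<Rightarrow> real \<Rightarrow> complex" where
  "time_freq_shift g = (\<lambda>(t, \<gamma>) x. g (x - t) * exp (2 * of_real pi * \<i> * of_real \<gamma> * of_real x))"

text \<open>
  The Gabor system is treated, as usual in frame theory, as the family indexed by the lattice points;
  for windows such as a non-zero polynomial times a Gaussian distinct lattice points give distinct
  elements of \<open>L\<^sup>2(\<real>)\<close>, so this agrees with viewing the system as a set.
\<close>

definition gabor_frame :: "(real \<Rightarrow> complex) \<Rightarrow> real \<Rightarrow> real \<Rightarrow> bool" where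
  "gabor_frame g \<alpha> \<beta> \<longleftrightarrow> L2_frame (gabor_lattice \<alpha> \<beta>) (time_freq_shift g)"

definition poly_gaussian :: "complex poly \<Rightarrow> real \<Rightarrow> real \<Rightarrow> complex" where
  "poly_gaussian p a x = poly p (of_real x) * of_real (exp (- a * x\<^sup>2))"

definition even_poly :: "complex poly \<Rightarrow> bool" where
  "even_poly p \<longleftrightarrow> (\<forall>x. poly p (- x) = poly p x)"

definition odd_poly :: "complex poly \<Rightarrow> bool" where
  "odd_poly p \<longleftrightarrow> (\<forall>x. poly p (- x) = - poly p x)"

end

theory Submission
  imports Defs
begin

text \<open>
  Put \<open>n = N + 1\<close> and \<open>b = 1 / \<beta> = n * \<alpha>\<close>.  Since the redundancy \<open>n\<close> is an integer, the Gabor system is a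
  union of \<open>n\<close> systems of critical density over the lattice \<open>b\<int> \<times> \<beta>\<int>\<close>, generated by the translates of the
  window by \<open>\<alpha> * r\<close> for \<open>r < n\<close>.  The Zak transform turns the frame operator into multiplication by
  \<open>\<Sum>r<n. \<bar>Z g (x - \<alpha> * r, z)\<bar>\<^sup>2\<close>, so for a continuous, rapidly decaying window a common zero of the \<open>n\<close>
  functions \<open>Z g (x - \<alpha> * r, z)\<close> destroys the lower frame bound.  This is
  \<open>not_gabor_frame_if_zak_zeros\<close>.  It is proved by testing the lower frame inequality on long truncated combs of
  narrow indicator functions, placed at the common zero: Bessel's inequality bounds the frame sum from above
  (\<open>comb_frame_sum_le\<close>), and the vanishing of the Zak transform makes all contributions small except those
  from the two ends of the comb, which are bounded independently of its length
  (\<open>sum_squares_shifted_windows_le\<close>).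

  It remains to find a polynomial for which such a zero exists at \<open>x = b / 2\<close>, \<open>z = (- 1) ^ n\<close>.  The
  \<open>n\<close> conditions are linear in the polynomial.  Among polynomials with the parity of \<open>N\<close> and degree at most
  \<open>N\<close> there are \<open>N div 2 + 1\<close> free coefficients.  Reflection at the origin (\<open>zak_reflection\<close>) exchanges the
  conditions for \<open>r\<close> and \<open>n - r\<close>; it shows that the condition for \<open>r = 0\<close>, and for even \<open>n\<close> also the one
  for \<open>r = n / 2\<close>, holds automatically.  What is left are the \<open>N div 2\<close> conditions for
  \<open>1 \<le> r \<le> N div 2\<close>, one fewer than there are unknowns, so a non-zero solution exists.
\<close>

section \<open>Geometrically decaying bilateral sequences\<close>

lemma summable_two_sided_geometric:
  fixes q :: real
  assumes "0 \<le> q" "q < 1"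
  shows "(\<lambda>k::int. q ^ nat \<bar>k\<bar>) summable_on UNIV"
proof -
  have geo: "(\<lambda>n::nat. q ^ n) summable_on UNIV"
    using assms by (subst summable_on_UNIV_nonneg_real_iff) (auto intro: summable_geometric)
  have "(\<lambda>k::int. q ^ nat \<bar>k\<bar>) summable_on range int"
    using geo by (subst summable_on_reindex) (auto simp: o_def)
  moreover have "(\<lambda>k::int. q ^ nat \<bar>k\<bar>) summable_on range (\<lambda>n. - int n)"
    using geo by (subst summable_on_reindex) (auto simp: o_def inj_on_def)
  ultimately have "(\<lambda>k::int. q ^ nat \<bar>k\<bar>) summable_on range int \<union> range (\<lambda>n. - int n)"
    by (rule summable_on_union)
  moreover have "range int \<union> range (\<lambda>n. - int n) = UNIV"
  proof (intro equalityI subsetI UNIV_I)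
    fix k :: int
    show "k \<in> range int \<union> range (\<lambda>n. - int n)"
      by (cases k rule: int_cases2) auto
  qed
  ultimately show ?thesis by simp
qed

text \<open>
  The hypothesis on \<open>X\<close> says that \<open>L\<close> lies between \<open>0\<close> and every point of \<open>X\<close>, so that the factor
  \<open>q ^ \<bar>L\<bar>\<close> can be pulled out of each term; what is left is dominated by the full geometric series
  centred at \<open>L\<close>.  Both the left and the right tails of a bilateral series are of this form.
\<close>

lemma geometric_tail_bound:
  fixes u :: "int \<Rightarrow> complex" and q C :: real
  assumes q: "0 \<le> q" "q < 1" and u: "\<And>i. cmod (u i) \<le> C * q ^ nat \<bar>i\<bar>"
    and X: "\<And>i. i \<in> X \<Longrightarrow> \<bar>i\<bar> = \<bar>L\<bar> + \<bar>i - L\<bar>"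
  shows "cmod (infsum u X) \<le> C * (\<Sum>\<^sub>\<infinity>i::int. q ^ nat \<bar>i\<bar>) * q ^ nat \<bar>L\<bar>"
proof -
  let ?w = "\<lambda>i::int. q ^ nat \<bar>i\<bar>"
  have C: "0 \<le> C" using order_trans[OF norm_ge_zero u[of 0]] by simp
  have sw: "?w summable_on UNIV" by (rule summable_two_sided_geometric[OF q])
  have shift: "(\<lambda>i. ?w (i - L)) summable_on UNIV \<and> (\<Sum>\<^sub>\<infinity>i. ?w (i - L)) = infsum ?w UNIV"
  proof -
    have "bij (\<lambda>i. i - L)" by (rule bij_betwI[of _ _ _ "\<lambda>i. i + L"]) auto
    from summable_on_reindex_bij_betw[OF this, of ?w] infsum_reindex_bij_betw[OF this, of ?w] sw
    show ?thesis by simp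
  qed
  have eq: "?w i = ?w L * ?w (i - L)" if "i \<in> X" for i
    using X[OF that] by (simp add: nat_add_distrib power_add)
  have abs: "(\<lambda>i. cmod (u i)) summable_on X"
    by (rule Infinite_Sum.abs_summable_on_comparison_test'[where g = "\<lambda>i. C * ?w i"])
       (use u in \<open>auto intro!: summable_on_cmult_right intro: summable_on_subset_banach[OF sw]\<close>)
  have sX: "(\<lambda>i. ?w (i - L)) summable_on X"
    using shift by (auto intro: summable_on_subset_banach)
  have "cmod (infsum u X) \<le> (\<Sum>\<^sub>\<infinity>i\<in>X. cmod (u i))"
    by (rule norm_infsum_bound[OF abs])
  also have "\<dots> \<le> (\<Sum>\<^sub>\<infinity>i\<in>X. C * ?w L * ?w (i - L))"
  proof (rule infsum_mono[OF abs])
    show "(\<lambda>i. C * ?w L * ?w (i - L)) summable_on X"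
      by (rule summable_on_cmult_right[OF sX])
    show "cmod (u i) \<le> C * ?w L * ?w (i - L)" if "i \<in> X" for i
      using u[of i] eq[OF that] by (simp add: mult.assoc)
  qed
  also have "\<dots> = C * ?w L * (\<Sum>\<^sub>\<infinity>i\<in>X. ?w (i - L))"
    by (rule infsum_cmult_right) (use sX in auto)
  also have "\<dots> \<le> C * ?w L * (\<Sum>\<^sub>\<infinity>i. ?w (i - L))"
    using C q shift sX by (intro mult_left_mono infsum_mono2) auto
  finally show ?thesis using shift by (simp add: mult_ac)
qed

text \<open>
  A window containing the origin captures the whole sum up to two tails; a window missing the origin is
  itself contained in a tail.  In either case only the end points of the window contribute once the
  total sum vanishes.
\<close>

lemma window_sum_bound:
  fixes u :: "int \<Rightarrow> complex" and q C :: real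
  assumes q: "0 \<le> q" "q < 1" and u: "\<And>i. cmod (u i) \<le> C * q ^ nat \<bar>i\<bar>" and LU: "L \<le> U"
  shows "cmod (\<Sum>i=L..U. u i) \<le> (if L \<le> 0 \<and> 0 \<le> U then cmod (\<Sum>\<^sub>\<infinity>i. u i) else 0)
      + C * (\<Sum>\<^sub>\<infinity>i::int. q ^ nat \<bar>i\<bar>) * (q ^ nat \<bar>L\<bar> + q ^ nat \<bar>U\<bar>)"
proof -
  let ?B = "\<lambda>L. C * (\<Sum>\<^sub>\<infinity>i::int. q ^ nat \<bar>i\<bar>) * q ^ nat \<bar>L\<bar>"
  note tail = geometric_tail_bound[OF q u]
  have C: "0 \<le> C" using order_trans[OF norm_ge_zero u[of 0]] by simp
  have B0: "0 \<le> ?B L" for L using C q by (intro mult_nonneg_nonneg infsum_nonneg) auto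
  have abs: "(\<lambda>i. cmod (u i)) summable_on UNIV"
    by (rule Infinite_Sum.abs_summable_on_comparison_test'[where g = "\<lambda>i. C * q ^ nat \<bar>i\<bar>"])
       (use u in \<open>auto intro!: summable_on_cmult_right summable_two_sided_geometric[OF q]\<close>)
  have su: "u summable_on X" for X
    using summable_on_subset_banach[OF abs_summable_summable[OF abs]] by blast
  consider "L \<le> 0 \<and> 0 \<le> U" | "0 < L" | "U < 0" by linarith
  then have "cmod (\<Sum>i=L..U. u i) \<le> (if L \<le> 0 \<and> 0 \<le> U then cmod (\<Sum>\<^sub>\<infinity>i. u i) else 0) + (?B L + ?B U)"
  proof cases
    case 1
    have "UNIV = {..<L} \<union> ({L..U} \<union> {U<..})" using LU by auto
    then have "infsum u UNIV = infsum u ({..<L} \<union> ({L..U} \<union> {U<..}))" by simp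
    also have "\<dots> = infsum u {..<L} + (infsum u {L..U} + infsum u {U<..})"
      using LU infsum_Un_disjoint[OF su su, of "{..<L}" "{L..U} \<union> {U<..}"]
        infsum_Un_disjoint[OF su su, of "{L..U}" "{U<..}"] by fastforce
    finally have "cmod (infsum u {L..U}) = cmod (infsum u UNIV - infsum u {..<L} - infsum u {U<..})"
      by (simp add: algebra_simps)
    moreover have "cmod (infsum u {..<L}) \<le> ?B L" using 1 by (intro tail) auto
    moreover have "cmod (infsum u {U<..}) \<le> ?B U" using 1 by (intro tail) auto
    ultimately have "cmod (infsum u {L..U}) \<le> cmod (infsum u UNIV) + ?B L + ?B U"
      using norm_triangle_ineq4[of "infsum u UNIV - infsum u {..<L}" "infsum u {U<..}"]
        norm_triangle_ineq4[of "infsum u UNIV" "infsum u {..<L}"] by linarith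
    then show ?thesis using 1 by simp
  next
    case 2
    then have "cmod (infsum u {L..U}) \<le> ?B L" by (intro tail) auto
    with 2 B0[of U] show ?thesis by simp
  next
    case 3
    then have "cmod (infsum u {L..U}) \<le> ?B U" by (intro tail) auto
    with 3 B0[of L] show ?thesis by simp
  qed
  then show ?thesis by (simp add: distrib_left)
qed

section \<open>Bessel's inequality on an interval\<close>

lemma integral_fourier_character:
  fixes b :: real and l :: int
  assumes "0 < b"
  shows "((\<lambda>t. cis (2 * pi * of_int l * t / b)) has_integral (if l = 0 then of_real b else 0)) {0..b}"
proof (cases "l = 0")
  case True
  then show ?thesis using has_integral_const_real[of "1::complex" 0 b] assms
    by (simp add: scaleR_conv_of_real)
next
  case False
  define c where "c = 2 * pi * of_int l / b"
  have c: "c \<noteq> 0" "c * b = 2 * pi * of_int l" using False assms by (auto simp: c_def)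
  have "((\<lambda>t. cis (c * t)) has_integral cis (c * b) / (\<i> * of_real c) - cis (c * 0) / (\<i> * of_real c)) {0..b}"
  proof (rule fundamental_theorem_of_calculus)
    show "0 \<le> b" using assms by simp
    fix x :: real
    have "((\<lambda>t. exp (\<i> * of_real c * t) / (\<i> * of_real c)) has_field_derivative
        exp (\<i> * of_real c * of_real x)) (at (of_real x))"
      by (rule derivative_eq_intros refl | use c in \<open>force\<close>)+
    from has_vector_derivative_real_field[OF this]
    show "((\<lambda>t. cis (c * t) / (\<i> * of_real c)) has_vector_derivative cis (c * x)) (at x within {0..b})"
      by (simp add: cis_conv_exp mult.assoc)
  qed
  moreover have "cis (c * b) = 1"
    unfolding c(2) by (rule cis_multiple_2pi) auto
  ultimately show ?thesis using False by (simp add: c_def mult.commute)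
qed

text \<open>
  The characters are orthogonal on the full period \<open>{0..b}\<close>, whereas \<open>H\<close> lives on the shorter interval
  \<open>{0..\<delta>}\<close>.  Instead of extending \<open>H\<close> by zero, which would destroy continuity, the proof integrates
  the non-negative function \<open>\<bar>H - P / b\<bar>\<^sup>2\<close> over \<open>{0..\<delta>}\<close>, where \<open>P\<close> is the Fourier sum of \<open>H\<close>, and
  enlarges the domain only in the term \<open>\<bar>P\<bar>\<^sup>2\<close>.
\<close>

lemma bessel_inequality_interval:
  fixes H :: "real \<Rightarrow> complex" and B :: "int set"
  assumes \<delta>: "0 \<le> \<delta>" "\<delta> \<le> b" "0 < b" and cont: "continuous_on {0..\<delta>} H" and B: "finite B"
  shows "(\<Sum>l\<in>B. (cmod (integral {0..\<delta>} (\<lambda>t. H t * cis (2 * pi * of_int l * t / b))))\<^sup>2)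
     \<le> b * integral {0..\<delta>} (\<lambda>t. (cmod (H t))\<^sup>2)"
proof -
  define e where "e = (\<lambda>(l::int) t. cis (2 * pi * of_int l * t / b))"
  have e_cont [continuous_intros]: "continuous_on A (e l)" for A l
    unfolding e_def by (intro continuous_intros continuous_on_cis) (use \<delta> in auto)
  define c where "c = (\<lambda>l. integral {0..\<delta>} (\<lambda>t. H t * e l t))"
  define s where "s = (\<Sum>l\<in>B. (cmod (c l))\<^sup>2)"
  define P where "P = (\<lambda>t. \<Sum>l\<in>B. c l * cnj (e l t))"
  have P_cont [continuous_intros]: "continuous_on A P" for A
    unfolding P_def by (intro continuous_intros)
  have HP: "((\<lambda>t. H t * cnj (P t)) has_integral of_real s) {0..\<delta>}"
  proof -
    have "((\<lambda>t. \<Sum>l\<in>B. cnj (c l) * (H t * e l t)) has_integral (\<Sum>l\<in>B. cnj (c l) * c l)) {0..\<delta>}"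
      unfolding c_def
      by (intro has_integral_sum B has_integral_mult_right integrable_integral
          integrable_continuous_interval continuous_intros cont)
    moreover have "H t * cnj (P t) = (\<Sum>l\<in>B. cnj (c l) * (H t * e l t))" for t
      by (simp add: P_def sum_distrib_left mult_ac)
    moreover have "(\<Sum>l\<in>B. cnj (c l) * c l) = of_real s"
      unfolding s_def of_real_sum
      by (intro sum.cong refl) (metis complex_norm_square mult.commute of_real_power)
    ultimately show ?thesis by simp
  qed
  have PP: "((\<lambda>t. of_real ((cmod (P t))\<^sup>2)) has_integral complex_of_real (b * s)) {0..b}"
  proof -
    have *: "((\<lambda>t. \<Sum>l\<in>B. \<Sum>m\<in>B. c l * cnj (c m) * e (m - l) t) has_integral
        (\<Sum>l\<in>B. \<Sum>m\<in>B. c l * cnj (c m) * (if m - l = 0 then of_real b else 0))) {0..b}"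
      unfolding e_def
      by (intro has_integral_sum B has_integral_mult_right integral_fourier_character \<delta>)
    have "of_real ((cmod (P t))\<^sup>2) = (\<Sum>l\<in>B. \<Sum>m\<in>B. c l * cnj (c m) * e (m - l) t)" for t
    proof -
      have "of_real ((cmod (P t))\<^sup>2) = P t * cnj (P t)" by (rule complex_norm_square)
      also have "\<dots> = (\<Sum>l\<in>B. \<Sum>m\<in>B. (c l * cnj (e l t)) * (cnj (c m) * e m t))"
        by (simp add: P_def sum_product)
      also have "\<dots> = (\<Sum>l\<in>B. \<Sum>m\<in>B. c l * cnj (c m) * e (m - l) t)"
        by (intro sum.cong refl)
          (simp add: e_def cis_cnj cis_mult diff_divide_distrib algebra_simps)
      finally show ?thesis .
    qed
    moreover have "(\<Sum>l\<in>B. \<Sum>m\<in>B. c l * cnj (c m) * (if m - l = 0 then of_real b else 0)) = of_real (b * s)"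
    proof -
      have "(\<Sum>l\<in>B. \<Sum>m\<in>B. c l * cnj (c m) * (if m - l = 0 then of_real b else 0))
          = (\<Sum>l\<in>B. c l * cnj (c l) * of_real b)"
      proof (intro sum.cong refl)
        fix l assume l: "l \<in> B"
        have "(\<Sum>m\<in>B. c l * cnj (c m) * (if m - l = 0 then of_real b else 0))
            = (\<Sum>m\<in>B. if m = l then c l * cnj (c l) * of_real b else 0)"
          by (intro sum.cong refl) auto
        then show "(\<Sum>m\<in>B. c l * cnj (c m) * (if m - l = 0 then of_real b else 0))
            = c l * cnj (c l) * of_real b"
          using l B by simp
      qed
      also have "\<dots> = of_real (b * s)"
        by (simp add: s_def sum_distrib_left sum_distrib_right complex_norm_square[symmetric] mult_ac)
      finally show ?thesis .
    qed
    ultimately show ?thesis using * by simp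
  qed
  have "(2 / b) * s \<le> integral {0..\<delta>} (\<lambda>t. (cmod (H t))\<^sup>2) + s / b"
  proof -
    have "(2 / b) * s = integral {0..\<delta>} (\<lambda>t. (2 / b) * Re (H t * cnj (P t)))"
      using has_integral_mult_right[OF has_integral_linear[OF HP bounded_linear_Re], of "2 / b"]
      by (simp only: o_def Re_complex_of_real integral_unique)
    also have "\<dots> \<le> integral {0..\<delta>} (\<lambda>t. (cmod (H t))\<^sup>2 + (cmod (P t))\<^sup>2 / b\<^sup>2)"
    proof (rule integral_le; (intro integrable_continuous_interval continuous_intros cont)?)
      fix t
      have "0 \<le> (cmod (H t - P t / of_real b))\<^sup>2" by simp
      also have "\<dots> = (cmod (H t))\<^sup>2 + (cmod (P t))\<^sup>2 / b\<^sup>2 - (2 / b) * Re (H t * cnj (P t))"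
        using \<delta> unfolding cmod_power2
        by (simp add: power2_diff power_divide) (simp add: field_simps power2_eq_square)
      finally show "(2 / b) * Re (H t * cnj (P t)) \<le> (cmod (H t))\<^sup>2 + (cmod (P t))\<^sup>2 / b\<^sup>2" by simp
    qed (use \<delta> in auto)
    also have "\<dots> = integral {0..\<delta>} (\<lambda>t. (cmod (H t))\<^sup>2) + integral {0..\<delta>} (\<lambda>t. (cmod (P t))\<^sup>2) / b\<^sup>2"
      using \<delta> by (subst integral_add) (auto intro!: integrable_continuous_interval continuous_intros cont)
    also have "integral {0..\<delta>} (\<lambda>t. (cmod (P t))\<^sup>2) \<le> integral {0..b} (\<lambda>t. (cmod (P t))\<^sup>2)"
      using \<delta> by (intro integral_subset_le integrable_continuous_interval continuous_intros) auto
    also have "integral {0..b} (\<lambda>t. (cmod (P t))\<^sup>2) = b * s"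
      using has_integral_linear[OF PP bounded_linear_Re] by (simp add: o_def integral_unique)
    finally show ?thesis using \<delta> by (simp add: divide_right_mono power2_eq_square)
  qed
  then have "s \<le> b * integral {0..\<delta>} (\<lambda>t. (cmod (H t))\<^sup>2)"
    using \<delta> by (simp add: field_simps)
  then show ?thesis by (simp add: s_def c_def e_def)
qed

section \<open>Truncated combs as test functions\<close>

text \<open>
  For small \<open>\<delta>\<close> this is, up to scaling, an approximation of the modulated Dirac comb
  \<open>\<Sum>k. cnj (z powi k) * \<delta>(x - x\<^sub>0 - b * k)\<close>, cut off to \<open>2 * K + 1\<close> teeth.  Pairing the full comb with
  \<open>cnj g\<close> gives the conjugate of the Zak transform of \<open>g\<close> at \<open>x\<^sub>0\<close>, hence the conjugated coefficients.
\<close>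

definition comb :: "real \<Rightarrow> complex \<Rightarrow> real \<Rightarrow> real \<Rightarrow> nat \<Rightarrow> real \<Rightarrow> complex" where
  "comb b z x\<^sub>0 \<delta> K x =
     (\<Sum>k\<in>{- int K..int K}. cnj (z powi k) * indicator {x\<^sub>0 + b * of_int k..x\<^sub>0 + b * of_int k + \<delta>} x)"

lemma cmod_comb_squared:
  assumes "0 < b" "0 \<le> \<delta>" "\<delta> < b" "cmod z = 1"
  shows "(cmod (comb b z x\<^sub>0 \<delta> K x))\<^sup>2
    = (\<Sum>k\<in>{- int K..int K}. indicator {x\<^sub>0 + b * of_int k..x\<^sub>0 + b * of_int k + \<delta>} x)"
proof -
  let ?I = "\<lambda>k::int. {x\<^sub>0 + b * of_int k..x\<^sub>0 + b * of_int k + \<delta>}"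
  show ?thesis
  proof (cases "\<exists>j\<in>{- int K..int K}. x \<in> ?I j")
    case True
    then obtain j where j: "j \<in> {- int K..int K}" "x \<in> ?I j" by blast
    have "x \<in> ?I k \<longleftrightarrow> k = j" for k
    proof
      assume "x \<in> ?I k"
      with j(2) have "b * of_int k \<le> b * of_int j + \<delta>" "b * of_int j \<le> b * of_int k + \<delta>" by auto
      then have "b * (of_int k - of_int j) < b * 1" "b * (of_int j - of_int k) < b * 1"
        using assms by (auto simp: algebra_simps)
      then have "real_of_int k - of_int j < 1" "real_of_int j - of_int k < 1"
        using assms(1) by (metis mult_less_cancel_left_pos)+
      then show "k = j" by linarith
    qed (use j in simp)
    then have ind: "indicator (?I k) x = (if k = j then 1 else 0 :: 'a::zero_neq_one)" for k
      by (simp add: indicator_def)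
    have "comb b z x\<^sub>0 \<delta> K x = cnj (z powi j)"
      unfolding comb_def ind using j(1) by (simp add: mult_delta_right)
    moreover have "(\<Sum>k\<in>{- int K..int K}. indicator (?I k) x) = (1::real)"
      unfolding ind using j(1) by simp
    ultimately show ?thesis using assms(4) by (simp add: norm_power_int)
  next
    case False
    then show ?thesis by (auto simp: comb_def)
  qed
qed

lemma comb_norm_integral:
  assumes "0 < b" "0 \<le> \<delta>" "\<delta> < b" "cmod z = 1"
  shows "has_bochner_integral lebesgue (\<lambda>x. (cmod (comb b z x\<^sub>0 \<delta> K x))\<^sup>2) ((2 * real K + 1) * \<delta>)"
proof -
  have "has_bochner_integral lebesgue
      (\<lambda>x. \<Sum>k\<in>{- int K..int K}. indicator {x\<^sub>0 + b * of_int k..x\<^sub>0 + b * of_int k + \<delta>} x :: real)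
      (\<Sum>k\<in>{- int K..int K}. measure lebesgue {x\<^sub>0 + b * of_int k..x\<^sub>0 + b * of_int k + \<delta>})"
    by (intro has_bochner_integral_sum has_bochner_integral_real_indicator)
       (auto simp: emeasure_lborel_Icc_eq)
  then show ?thesis
    using assms(2) by (simp add: cmod_comb_squared[OF assms] algebra_simps)
qed

lemma comb_in_L2:
  assumes "0 < b" "0 \<le> \<delta>" "\<delta> < b" "cmod z = 1"
  shows "comb b z x\<^sub>0 \<delta> K \<in> L2" and "(L2_norm (comb b z x\<^sub>0 \<delta> K))\<^sup>2 = (2 * real K + 1) * \<delta>"
proof -
  have "comb b z x\<^sub>0 \<delta> K \<in> borel_measurable lebesgue"
    unfolding comb_def
    by (intro borel_measurable_sum borel_measurable_times borel_measurable_const borel_measurable_indicator)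
       auto
  then show "comb b z x\<^sub>0 \<delta> K \<in> L2"
    using comb_norm_integral[OF assms] by (auto simp: L2_def has_bochner_integral_iff)
  show "(L2_norm (comb b z x\<^sub>0 \<delta> K))\<^sup>2 = (2 * real K + 1) * \<delta>"
    using comb_norm_integral[OF assms, of x\<^sub>0 K] assms(2)
    by (simp add: L2_norm_def has_bochner_integral_iff)
qed

text \<open>
  The modulation by \<open>l / b\<close> has period \<open>b\<close> up to the integer \<open>l\<close>, so it takes the same values on all
  teeth of the comb and the inner product folds to a single Fourier coefficient on \<open>{0..\<delta>}\<close>.
\<close>

lemma comb_inner_time_freq_shift:
  assumes "continuous_on UNIV g" "0 < b" "0 \<le> \<delta>"
  shows "cmod (L2_inner (comb b z x\<^sub>0 \<delta> K) (time_freq_shift g (\<tau>, of_int l / b)))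
    = cmod (integral {0..\<delta>} (\<lambda>t. (\<Sum>k\<in>{- int K..int K}. z powi k * g (x\<^sub>0 - \<tau> + t + b * of_int k))
         * cis (2 * pi * of_int l * t / b)))"
proof -
  define \<phi> where "\<phi> = (\<lambda>x. cnj (g (x - \<tau>) * cis (2 * pi * of_int l * x / b)))"
  have tfs: "cnj (time_freq_shift g (\<tau>, of_int l / b) x) = \<phi> x" for x
    by (simp add: time_freq_shift_def \<phi>_def cis_conv_exp mult_ac)
  have g_cont [continuous_intros]: "continuous_on A (\<lambda>x. g (f x))" if "continuous_on A f" for A f
    using continuous_on_compose2[OF assms(1) that] by simp
  have \<phi>_cont: "continuous_on A \<phi>" for A
    unfolding \<phi>_def using assms(2) by (intro continuous_intros continuous_on_cis) auto
  let ?I = "\<lambda>k::int. {x\<^sub>0 + b * of_int k..x\<^sub>0 + b * of_int k + \<delta>}"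
  have int: "set_integrable lebesgue (?I k) \<phi>" for k
    by (intro absolutely_integrable_continuous_real \<phi>_cont)
  have shift: "integral (?I k) \<phi> = integral {0..\<delta>} (\<lambda>t. cnj (cis (2 * pi * of_int l * x\<^sub>0 / b))
      * cnj (g (x\<^sub>0 - \<tau> + t + b * of_int k) * cis (2 * pi * of_int l * t / b)))" for k
  proof -
    have "integral (?I k) \<phi> = integral {0..\<delta>} (\<lambda>t. \<phi> (t + (x\<^sub>0 + b * of_int k)))"
      using integral_shift_real_ivl[of "x\<^sub>0 + b * of_int k" "x\<^sub>0 + b * of_int k" "x\<^sub>0 + b * of_int k + \<delta>" \<phi>]
      by simp
    moreover have "cis (2 * pi * of_int l * (t + (x\<^sub>0 + b * of_int k)) / b)
        = cis (2 * pi * of_int l * x\<^sub>0 / b) * cis (2 * pi * of_int l * t / b)" for t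
    proof -
      have "2 * pi * of_int l * (t + (x\<^sub>0 + b * of_int k)) / b
          = 2 * pi * of_int l * x\<^sub>0 / b + 2 * pi * of_int l * t / b + 2 * pi * of_int (l * k)"
        using assms(2) by (simp add: field_simps)
      moreover have "cis (2 * pi * of_int (l * k)) = 1" by (rule cis_multiple_2pi) (rule Ints_of_int)
      ultimately show ?thesis by (simp only: cis_mult[symmetric]) simp
    qed
    ultimately show ?thesis by (simp add: \<phi>_def algebra_simps)
  qed
  have "L2_inner (comb b z x\<^sub>0 \<delta> K) (time_freq_shift g (\<tau>, of_int l / b))
      = integral\<^sup>L lebesgue (\<lambda>x. \<Sum>k\<in>{- int K..int K}. cnj (z powi k) * (indicator (?I k) x *\<^sub>R \<phi> x))"
    unfolding L2_inner_def comb_def tfs sum_distrib_right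
    by (intro Bochner_Integration.integral_cong refl sum.cong) (simp split: split_indicator)
  also have "\<dots> = (\<Sum>k\<in>{- int K..int K}. cnj (z powi k) * integral (?I k) \<phi>)"
  proof -
    have "integrable lebesgue (\<lambda>x. cnj (z powi k) * (indicator (?I k) x *\<^sub>R \<phi> x))" for k
      using int[of k] unfolding set_integrable_def by (rule integrable_mult_right)
    moreover have "integral\<^sup>L lebesgue (\<lambda>x. cnj (z powi k) * (indicator (?I k) x *\<^sub>R \<phi> x))
        = cnj (z powi k) * integral (?I k) \<phi>" for k
      using set_lebesgue_integral_eq_integral(2)[OF int[of k]] unfolding set_lebesgue_integral_def
      by (simp only: Bochner_Integration.integral_mult_right_zero)
    ultimately show ?thesis
      by (simp only: Bochner_Integration.integral_sum)
  qed
  also have "\<dots> = integral {0..\<delta>} (\<lambda>t. \<Sum>k\<in>{- int K..int K}. cnj (z powi k) *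
      (cnj (cis (2 * pi * of_int l * x\<^sub>0 / b))
      * cnj (g (x\<^sub>0 - \<tau> + t + b * of_int k) * cis (2 * pi * of_int l * t / b))))"
    unfolding shift
    by (subst integral_sum)
       (use assms(2) in \<open>auto intro!: integrable_continuous_interval continuous_intros continuous_on_cis\<close>)
  also have "\<dots> = integral {0..\<delta>} (\<lambda>t. cnj (cis (2 * pi * of_int l * x\<^sub>0 / b)) * cnj (
      (\<Sum>k\<in>{- int K..int K}. z powi k * g (x\<^sub>0 - \<tau> + t + b * of_int k)) * cis (2 * pi * of_int l * t / b)))"
    by (rule arg_cong[where f = "integral _"]) (auto simp: sum_distrib_left sum_distrib_right mult_ac)
  finally show ?thesis
    by (simp only: Henstock_Kurzweil_Integration.integral_mult_right norm_mult complex_mod_cnj norm_cis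
        Henstock_Kurzweil_Integration.integral_cnj[symmetric] mult_1)
qed

section \<open>The Zak transform and failure of the frame property\<close>

text \<open>
  The Zak transform with period \<open>b\<close>; the dual variable appears as a point \<open>z\<close>, in the applications on the
  unit circle.
\<close>

definition zak :: "real \<Rightarrow> complex \<Rightarrow> (real \<Rightarrow> complex) \<Rightarrow> real \<Rightarrow> complex" where
  "zak b z g x = (\<Sum>\<^sub>\<infinity>k::int. z powi k * g (x + b * of_int k))"

lemma zak_term_bound:
  assumes decay: "\<And>x. cmod (g x) \<le> M * exp (- \<bar>x\<bar>)" and "0 < b" "cmod z = 1" and x: "\<bar>x\<bar> \<le> Y"
  shows "cmod (z powi k * g (x + b * of_int k)) \<le> M * exp Y * exp (- b) ^ nat \<bar>k\<bar>"
proof -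
  have M: "0 \<le> M" using order_trans[OF norm_ge_zero decay[of 0]] by simp
  have "\<bar>b * of_int k\<bar> \<le> \<bar>x + b * of_int k\<bar> + \<bar>x\<bar>" by linarith
  then have "- \<bar>x + b * of_int k\<bar> \<le> Y + real (nat \<bar>k\<bar>) * (- b)"
    using x assms(2) by (simp add: abs_mult mult.commute)
  then have "exp (- \<bar>x + b * of_int k\<bar>) \<le> exp (Y + real (nat \<bar>k\<bar>) * (- b))" by simp
  also have "\<dots> = exp Y * exp (- b) ^ nat \<bar>k\<bar>" by (simp only: exp_add exp_of_nat_mult)
  finally have "M * exp (- \<bar>x + b * of_int k\<bar>) \<le> M * (exp Y * exp (- b) ^ nat \<bar>k\<bar>)"
    using M by (rule mult_left_mono)
  with decay[of "x + b * of_int k"] show ?thesis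
    using assms(3) by (simp add: norm_mult norm_power_int mult.assoc)
qed

lemma summable_zak:
  assumes decay: "\<And>x. cmod (g x) \<le> M * exp (- \<bar>x\<bar>)" and "0 < b" "cmod z = 1"
  shows "(\<lambda>k::int. z powi k * g (x + b * of_int k)) summable_on UNIV"
proof (rule abs_summable_summable, rule Infinite_Sum.abs_summable_on_comparison_test')
  show "(\<lambda>k::int. M * exp \<bar>x\<bar> * exp (- b) ^ nat \<bar>k\<bar>) summable_on UNIV"
    using assms(2) by (intro summable_on_cmult_right summable_two_sided_geometric) auto
qed (rule zak_term_bound[OF decay assms(2,3) order_refl])

text \<open>
  On a bounded interval the defining series is dominated by a fixed geometric series, so it converges
  uniformly there.
\<close>

lemma isCont_zak:
  assumes cont: "continuous_on UNIV g" and decay: "\<And>x. cmod (g x) \<le> M * exp (- \<bar>x\<bar>)"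
    and b: "0 < b" and z: "cmod z = 1"
  shows "isCont (zak b z g) x"
proof -
  define S where "S = {- (\<bar>x\<bar> + 1)<..<\<bar>x\<bar> + 1}"
  have "continuous_on S (\<lambda>y. \<Sum>\<^sub>\<infinity>k::int. z powi k * g (y + b * of_int k))"
  proof (rule uniform_limit_theorem)
    show "uniform_limit S (\<lambda>F y. \<Sum>k\<in>F. z powi k * g (y + b * of_int k))
        (\<lambda>y. \<Sum>\<^sub>\<infinity>k::int. z powi k * g (y + b * of_int k)) (finite_subsets_at_top UNIV)"
    proof (rule Weierstrass_m_test_general)
      show "cmod (z powi k * g (y + b * of_int k)) \<le> M * exp (\<bar>x\<bar> + 1) * exp (- b) ^ nat \<bar>k\<bar>"
        if "y \<in> S" for k y
        using that by (intro zak_term_bound[OF decay b z]) (auto simp: S_def)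
      show "(\<lambda>k::int. M * exp (\<bar>x\<bar> + 1) * exp (- b) ^ nat \<bar>k\<bar>) summable_on UNIV"
        using b by (intro summable_on_cmult_right summable_two_sided_geometric) auto
    qed
    show "\<forall>\<^sub>F F in finite_subsets_at_top UNIV. continuous_on S (\<lambda>y. \<Sum>k\<in>F. z powi k * g (y + b * of_int k))"
      by (intro always_eventually allI continuous_intros continuous_on_compose2[OF cont]) auto
  qed simp
  then have "continuous_on S (zak b z g)" by (simp add: zak_def[abs_def])
  moreover have "open S" "x \<in> S" by (auto simp: S_def)
  ultimately show ?thesis using continuous_on_eq_continuous_at by blast
qed

text \<open>
  For a fixed translation \<open>\<alpha> * m\<close> the sum over all modulations is a sum of squared Fourier coefficients, which
  Bessel's inequality bounds by an integral; the sum over the translations is then estimated under the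
  integral sign.
\<close>

lemma comb_frame_sum_le:
  assumes cont: "continuous_on UNIV g" and "0 < \<alpha>" "0 < b" "0 \<le> \<delta>" "\<delta> \<le> b"
    and summable: "(\<lambda>i. (cmod (L2_inner (comb b z x\<^sub>0 \<delta> K) (time_freq_shift g i)))\<^sup>2)
      summable_on gabor_lattice \<alpha> (1 / b)"
    and D: "\<And>t J. 0 \<le> t \<Longrightarrow> t \<le> \<delta> \<Longrightarrow> finite J \<Longrightarrow>
      (\<Sum>m\<in>J. (cmod (\<Sum>k\<in>{- int K..int K}. z powi k * g (x\<^sub>0 - \<alpha> * of_int m + t + b * of_int k)))\<^sup>2) \<le> D"
  shows "(\<Sum>\<^sub>\<infinity>i\<in>gabor_lattice \<alpha> (1 / b). (cmod (L2_inner (comb b z x\<^sub>0 \<delta> K) (time_freq_shift g i)))\<^sup>2)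
    \<le> b * (D * \<delta>)"
proof (rule infsum_le_finite_sums[OF summable])
  fix F assume F: "finite F" "F \<subseteq> gabor_lattice \<alpha> (1 / b)"
  define c where "c = (\<lambda>i. (cmod (L2_inner (comb b z x\<^sub>0 \<delta> K) (time_freq_shift g i)))\<^sup>2)"
  define p where "p = (\<lambda>(m::int, l::int). (\<alpha> * of_int m, of_int l / b))"
  define H where "H = (\<lambda>m t. \<Sum>k\<in>{- int K..int K}. z powi k * g (x\<^sub>0 - \<alpha> * of_int m + t + b * of_int k))"
  have H_cont [continuous_intros]: "continuous_on A (H m)" for A m
    unfolding H_def by (intro continuous_intros continuous_on_compose2[OF cont]) auto
  have "gabor_lattice \<alpha> (1 / b) = range p"
    by (auto simp: gabor_lattice_def p_def image_iff)
  with F obtain C where C: "finite C" "F = p ` C"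
    by (metis finite_subset_image)
  define J where "J = fst ` C"
  define B where "B = snd ` C"
  have fin: "finite J" "finite B" using C by (auto simp: J_def B_def)
  have "inj p" using assms(2,3) by (auto simp: inj_on_def p_def)
  have "sum c F \<le> sum c (p ` (J \<times> B))"
    using fin C by (intro sum_mono2) (auto simp: J_def B_def c_def image_iff intro!: bexI rev_bexI)
  also have "\<dots> = (\<Sum>m\<in>J. \<Sum>l\<in>B. c (p (m, l)))"
    using inj_on_subset[OF \<open>inj p\<close>] by (subst sum.reindex) (auto simp: sum.cartesian_product)
  also have "\<dots> \<le> (\<Sum>m\<in>J. b * integral {0..\<delta>} (\<lambda>t. (cmod (H m t))\<^sup>2))"
  proof (rule sum_mono)
    fix m
    have "(\<Sum>l\<in>B. c (p (m, l)))
        = (\<Sum>l\<in>B. (cmod (integral {0..\<delta>} (\<lambda>t. H m t * cis (2 * pi * of_int l * t / b))))\<^sup>2)"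
      using comb_inner_time_freq_shift[OF cont assms(3,4)]
      by (simp add: c_def p_def H_def)
    also have "\<dots> \<le> b * integral {0..\<delta>} (\<lambda>t. (cmod (H m t))\<^sup>2)"
      using assms fin by (intro bessel_inequality_interval H_cont) auto
    finally show "(\<Sum>l\<in>B. c (p (m, l))) \<le> b * integral {0..\<delta>} (\<lambda>t. (cmod (H m t))\<^sup>2)" .
  qed
  also have "\<dots> = b * integral {0..\<delta>} (\<lambda>t. \<Sum>m\<in>J. (cmod (H m t))\<^sup>2)"
    using fin by (subst integral_sum)
      (auto simp: sum_distrib_left intro!: integrable_continuous_interval continuous_intros)
  also have "integral {0..\<delta>} (\<lambda>t. \<Sum>m\<in>J. (cmod (H m t))\<^sup>2) \<le> integral {0..\<delta>} (\<lambda>t. D)"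
    using D fin by (intro integral_le integrable_continuous_interval continuous_intros) (auto simp: H_def)
  finally show "(\<Sum>i\<in>F. (cmod (L2_inner (comb b z x\<^sub>0 \<delta> K) (time_freq_shift g i)))\<^sup>2) \<le> b * (D * \<delta>)"
    using assms(3,4) by (simp add: c_def mult.commute)
qed

text \<open>
  This is the heart of the estimate.  For each residue class modulo \<open>n\<close>, the window of length
  \<open>2 * K + 1\<close> slides over a sequence with nearly vanishing sum.  All \<open>2 * K + 1\<close> positions in which it
  covers the origin cost \<open>\<epsilon>\<^sup>2\<close> each, up to a constant factor, and apart from that only the
  positions with an end point near the origin matter; their total contribution is bounded
  independently of \<open>K\<close>.
\<close>

lemma sum_squares_shifted_windows_le:
  fixes u :: "int \<Rightarrow> int \<Rightarrow> complex" and n K :: nat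
  defines "Q \<equiv> (\<lambda>q. \<Sum>\<^sub>\<infinity>i::int. q ^ nat \<bar>i\<bar>)"
  assumes q: "0 \<le> q" "q < 1" and n: "0 < n" and J: "finite J"
    and u: "\<And>r i. 0 \<le> r \<Longrightarrow> r < int n \<Longrightarrow> cmod (u r i) \<le> C * q ^ nat \<bar>i\<bar>"
    and small: "\<And>r. 0 \<le> r \<Longrightarrow> r < int n \<Longrightarrow> cmod (\<Sum>\<^sub>\<infinity>i. u r i) \<le> \<epsilon>"
  shows "(\<Sum>m\<in>J. (cmod (\<Sum>i=- int K - m div int n..int K - m div int n. u (m mod int n) i))\<^sup>2)
    \<le> 3 * real n * ((2 * real K + 1) * \<epsilon>\<^sup>2 + 2 * (C * Q q)\<^sup>2 * Q q)"
proof -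
  define E where "E = (C * Q q)\<^sup>2"
  define B where "B = (\<lambda>j. 3 * ((if \<bar>j\<bar> \<le> int K then \<epsilon> else 0)\<^sup>2
    + E * q ^ nat \<bar>- int K - j\<bar> + E * q ^ nat \<bar>int K - j\<bar>))"
  have \<epsilon>: "0 \<le> \<epsilon>" using order_trans[OF norm_ge_zero small[of 0]] n by simp
  have E: "0 \<le> E" by (simp add: E_def)
  have B0: "0 \<le> B j" for j using E q by (auto simp: B_def)
  have bound: "(cmod (\<Sum>i=- int K - j..int K - j. u r i))\<^sup>2 \<le> B j" if r: "0 \<le> r" "r < int n" for r j
  proof -
    let ?x = "if \<bar>j\<bar> \<le> int K then \<epsilon> else 0"
    let ?a = "q ^ nat \<bar>- int K - j\<bar>" and ?b = "q ^ nat \<bar>int K - j\<bar>"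
    have ab: "0 \<le> ?a" "?a \<le> 1" "0 \<le> ?b" "?b \<le> 1" using q by (auto intro: power_le_one)
    have "cmod (\<Sum>i=- int K - j..int K - j. u r i) \<le> ?x + C * Q q * (?a + ?b)"
      using window_sum_bound[OF q u[OF r], of "- int K - j" "int K - j"] small[OF r]
      by (auto simp: Q_def split: if_splits)
    then have "(cmod (\<Sum>i=- int K - j..int K - j. u r i))\<^sup>2 \<le> (?x + C * Q q * ?a + C * Q q * ?b)\<^sup>2"
      by (intro power_mono) (auto simp: algebra_simps)
    also have "\<dots> \<le> 3 * (?x\<^sup>2 + (C * Q q * ?a)\<^sup>2 + (C * Q q * ?b)\<^sup>2)"
    proof -
      have "(x + y + w)\<^sup>2 \<le> 3 * (x\<^sup>2 + y\<^sup>2 + w\<^sup>2)" for x y w :: real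
        using zero_le_power2[of "x - y"] zero_le_power2[of "x - w"] zero_le_power2[of "y - w"]
        by (simp add: power2_eq_square algebra_simps)
      then show ?thesis .
    qed
    also have "\<dots> = 3 * (?x\<^sup>2 + E * ?a\<^sup>2 + E * ?b\<^sup>2)"
      by (simp only: E_def power_mult_distrib)
    also have "\<dots> \<le> 3 * (?x\<^sup>2 + E * ?a + E * ?b)"
      using ab E by (intro mult_left_mono add_mono order_refl) (auto simp: power2_eq_square intro: mult_left_le)
    finally show ?thesis by (simp only: B_def)
  qed
  define J' where "J' = (\<lambda>m. m div int n) ` J"
  have "(\<Sum>m\<in>J. (cmod (\<Sum>i=- int K - m div int n..int K - m div int n. u (m mod int n) i))\<^sup>2)
      \<le> (\<Sum>m\<in>J. B (m div int n))"
    using n by (intro sum_mono bound) auto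
  also have "\<dots> \<le> (\<Sum>p\<in>{0..<int n} \<times> J'. B (snd p))"
  proof (rule sum_le_included[where i = "\<lambda>(r, j). r + int n * j"])
    show "finite J" "finite ({0..<int n} \<times> J')" using J by (auto simp: J'_def)
    show "\<forall>m\<in>J. \<exists>p\<in>{0..<int n} \<times> J'. (case p of (r, j) \<Rightarrow> r + int n * j) = m \<and> B (m div int n) \<le> B (snd p)"
      using n by (intro ballI bexI[of _ "(m mod int n, m div int n)" for m]) (auto simp: J'_def)
  qed (use B0 in auto)
  also have "\<dots> = real n * (\<Sum>j\<in>J'. B j)"
    using sum.cartesian_product[of "\<lambda>r. B" J' "{0..<int n}"] by (simp add: case_prod_unfold)
  also have "(\<Sum>j\<in>J'. B j) \<le> 3 * ((2 * real K + 1) * \<epsilon>\<^sup>2 + E * Q q + E * Q q)"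
  proof -
    have J': "finite J'" using J by (simp add: J'_def)
    have geo: "(\<Sum>j\<in>J'. q ^ nat \<bar>a - j\<bar>) \<le> Q q" for a :: int
    proof -
      have "(\<Sum>j\<in>J'. q ^ nat \<bar>a - j\<bar>) = (\<Sum>i\<in>(\<lambda>j. a - j) ` J'. q ^ nat \<bar>i\<bar>)"
        by (subst sum.reindex) (auto simp: inj_on_def)
      also have "\<dots> \<le> Q q"
        unfolding Q_def using q J' by (intro finite_sum_le_infsum summable_two_sided_geometric) auto
      finally show ?thesis .
    qed
    have "(\<Sum>j\<in>J'. (if \<bar>j\<bar> \<le> int K then \<epsilon> else 0)\<^sup>2) = (\<Sum>j\<in>J' \<inter> {- int K..int K}. \<epsilon>\<^sup>2)"
      using J' by (subst sum.inter_restrict) (auto intro!: sum.cong)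
    also have "\<dots> \<le> (\<Sum>j\<in>{- int K..int K}. \<epsilon>\<^sup>2)" by (intro sum_mono2) auto
    also have "\<dots> = (2 * real K + 1) * \<epsilon>\<^sup>2" by simp
    finally have "(\<Sum>j\<in>J'. (if \<bar>j\<bar> \<le> int K then \<epsilon> else 0)\<^sup>2) \<le> (2 * real K + 1) * \<epsilon>\<^sup>2" .
    then show ?thesis
      unfolding B_def sum_distrib_left[symmetric] sum.distrib
      by (intro mult_left_mono add_mono geo E) auto
  qed
  finally show ?thesis using n by (simp add: E_def algebra_simps)
qed

text \<open>
  The translations by \<open>\<alpha> * m\<close> with \<open>m\<close> in one residue class modulo \<open>n\<close> differ by multiples of the
  period \<open>b\<close>, so tested on a comb they see one and the same bilateral sequence, whose sum is a value of the
  Zak transform near one of the \<open>n\<close> zeros.  With \<open>2 * K + 1\<close> teeth of width \<open>\<delta>\<close> the frame sum is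
  therefore at most \<open>\<delta>\<close> times a small multiple of \<open>2 * K + 1\<close> plus a constant, while the squared norm is
  exactly \<open>(2 * K + 1) * \<delta>\<close>.  Letting \<open>K\<close> grow contradicts any lower frame bound.
\<close>

proposition not_gabor_frame_if_zak_zeros:
  fixes g :: "real \<Rightarrow> complex"
  assumes cont: "continuous_on UNIV g" and decay: "\<And>x. cmod (g x) \<le> M * exp (- \<bar>x\<bar>)"
    and \<alpha>: "0 < \<alpha>" and \<beta>: "0 < \<beta>" and n: "0 < n" "\<alpha> * \<beta> = 1 / real n" and z: "cmod z = 1"
    and zeros: "\<And>r. r < n \<Longrightarrow> zak (1 / \<beta>) z g (x\<^sub>0 - \<alpha> * real r) = 0"
  shows "\<not> gabor_frame g \<alpha> \<beta>"
proof
  assume frame: "gabor_frame g \<alpha> \<beta>"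
  define b where "b = 1 / \<beta>"
  have b: "0 < b" "b = real n * \<alpha>" "\<beta> = 1 / b"
    using \<beta> n by (auto simp: b_def field_simps)
  obtain A where A: "0 < A" and lower: "\<And>f. f \<in> L2 \<Longrightarrow>
      (\<lambda>i. (cmod (L2_inner f (time_freq_shift g i)))\<^sup>2) summable_on gabor_lattice \<alpha> \<beta> \<and>
      A * (L2_norm f)\<^sup>2 \<le> (\<Sum>\<^sub>\<infinity>i\<in>gabor_lattice \<alpha> \<beta>. (cmod (L2_inner f (time_freq_shift g i)))\<^sup>2)"
    using frame unfolding gabor_frame_def L2_frame_def by blast
  define q where "q = exp (- b)"
  have q: "0 \<le> q" "q < 1" using b(1) by (auto simp: q_def)
  define Q where "Q = (\<Sum>\<^sub>\<infinity>i::int. q ^ nat \<bar>i\<bar>)"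
  have Q: "0 \<le> Q" unfolding Q_def using q by (intro infsum_nonneg) auto
  define C where "C = M * exp (\<bar>x\<^sub>0\<bar> + b + b)"
  define D where "D = 6 * b * real n * (C * Q)\<^sup>2 * Q"

  \<comment> \<open>This value lets the near-zero part of the frame sum use up only half of the lower bound.\<close>
  define \<epsilon> where "\<epsilon> = sqrt (A / (6 * b * real n))"
  have \<epsilon>: "0 < \<epsilon>" "b * (3 * real n * \<epsilon>\<^sup>2) = A / 2" using A b(1) n(1) by (auto simp: \<epsilon>_def)
  \<comment> \<open>Continuity at the finitely many zeros; \<open>\<delta>\<close> depends on \<open>\<epsilon>\<close> but not on \<open>K\<close>.\<close>
  have "\<exists>\<delta>>0. \<delta> < b \<and> (\<forall>t. 0 \<le> t \<and> t \<le> \<delta> \<longrightarrow> (\<forall>r<n. cmod (zak b z g (x\<^sub>0 - \<alpha> * real r + t)) \<le> \<epsilon>))"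
  proof -
    have "\<forall>\<^sub>F t in at_right 0. \<forall>r\<in>{..<n}. cmod (zak b z g (x\<^sub>0 - \<alpha> * real r + t)) < \<epsilon>"
    proof (rule eventually_ball_finite)
      show "\<forall>r\<in>{..<n}. \<forall>\<^sub>F t in at_right 0. cmod (zak b z g (x\<^sub>0 - \<alpha> * real r + t)) < \<epsilon>"
      proof
        fix r assume r: "r \<in> {..<n}"
        have "isCont (\<lambda>t. cmod (zak b z g (x\<^sub>0 - \<alpha> * real r + t))) 0"
          by (intro isCont_norm isCont_o2[OF _ isCont_zak[OF cont decay b(1) z]] continuous_intros)
        then have "((\<lambda>t. cmod (zak b z g (x\<^sub>0 - \<alpha> * real r + t))) \<longlongrightarrow> 0) (at_right 0)"
          using zeros[of r] r by (auto simp: isCont_def b_def intro: filterlim_mono[OF _ order_refl at_le])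
        then show "\<forall>\<^sub>F t in at_right 0. cmod (zak b z g (x\<^sub>0 - \<alpha> * real r + t)) < \<epsilon>"
          using \<epsilon>(1) by (rule order_tendstoD(2))
      qed
    qed simp
    then obtain d where d: "0 < d" "\<And>t r. 0 < t \<Longrightarrow> t < d \<Longrightarrow> r < n \<Longrightarrow>
        cmod (zak b z g (x\<^sub>0 - \<alpha> * real r + t)) < \<epsilon>"
      unfolding eventually_at_right_field by auto
    have "cmod (zak b z g (x\<^sub>0 - \<alpha> * real r + t)) \<le> \<epsilon>"
      if "0 \<le> t" "t \<le> min d b / 2" "r < n" for t r
    proof (cases "t = 0")
      case True
      then show ?thesis using zeros[OF \<open>r < n\<close>] \<epsilon>(1) by (simp add: b_def)
    next
      case False
      then show ?thesis using that d(1) by (intro less_imp_le d(2)) auto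
    qed
    then show ?thesis using d(1) b(1) by (intro exI[of _ "min d b / 2"]) auto
  qed
  then obtain \<delta> where \<delta>: "0 < \<delta>" "\<delta> < b" and small: "\<And>t r. 0 \<le> t \<Longrightarrow> t \<le> \<delta> \<Longrightarrow> r < n \<Longrightarrow>
      cmod (zak b z g (x\<^sub>0 - \<alpha> * real r + t)) \<le> \<epsilon>" by blast

  have bound: "A / 2 * (2 * real K + 1) \<le> D" for K
  proof -
    define W where "W = 3 * real n * ((2 * real K + 1) * \<epsilon>\<^sup>2 + 2 * (C * Q)\<^sup>2 * Q)"
    have window: "(\<Sum>m\<in>J. (cmod (\<Sum>k\<in>{- int K..int K}. z powi k * g (x\<^sub>0 - \<alpha> * of_int m + t + b * of_int k)))\<^sup>2) \<le> W"
      if t: "0 \<le> t" "t \<le> \<delta>" and J: "finite J" for t J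
    proof -
      define u where "u = (\<lambda>r i. z powi i * g (x\<^sub>0 - \<alpha> * of_int r + t + b * of_int i))"
      have "cmod (\<Sum>k\<in>{- int K..int K}. z powi k * g (x\<^sub>0 - \<alpha> * of_int m + t + b * of_int k))
          = cmod (\<Sum>i=- int K - m div int n..int K - m div int n. u (m mod int n) i)" for m
      proof -
        define j where "j = m div int n"
        define r where "r = m mod int n"
        have m: "m = r + int n * j" by (simp add: j_def r_def)
        have z0: "z \<noteq> 0" using z by auto
        have "(\<Sum>k\<in>{- int K..int K}. z powi k * g (x\<^sub>0 - \<alpha> * of_int m + t + b * of_int k))
            = (\<Sum>i=- int K - j..int K - j. z powi j * u r i)"
        proof (rule sum.reindex_bij_witness[where i = "\<lambda>i. i + j" and j = "\<lambda>k. k - j"])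
          fix k
          have "x\<^sub>0 - \<alpha> * of_int m + t + b * of_int k = x\<^sub>0 - \<alpha> * of_int r + t + b * of_int (k - j)"
            by (simp add: m b(2) algebra_simps)
          moreover have "z powi k = z powi j * z powi (k - j)"
            using z0 by (simp flip: power_int_add)
          ultimately show "z powi j * u r (k - j) = z powi k * g (x\<^sub>0 - \<alpha> * of_int m + t + b * of_int k)"
            by (simp only: u_def mult.assoc)
        qed auto
        then show ?thesis
          using z by (simp add: norm_mult norm_power_int j_def r_def flip: sum_distrib_left)
      qed
      moreover have "(\<Sum>m\<in>J. (cmod (\<Sum>i=- int K - m div int n..int K - m div int n. u (m mod int n) i))\<^sup>2) \<le> W"
        unfolding W_def Q_def
      proof (rule sum_squares_shifted_windows_le[OF q n(1) J])
        fix r i :: int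
        assume r: "0 \<le> r" "r < int n"
        have "\<alpha> * of_int r \<le> \<alpha> * real n"
          using r(2) \<alpha> by (intro mult_left_mono) auto
        moreover have "0 \<le> \<alpha> * of_int r" using r(1) \<alpha> by simp
        ultimately have "\<bar>x\<^sub>0 - \<alpha> * of_int r + t\<bar> \<le> \<bar>x\<^sub>0\<bar> + b + b"
          using t \<delta> b(2) by (simp add: mult.commute)
        then show "cmod (u r i) \<le> C * q ^ nat \<bar>i\<bar>"
          unfolding u_def C_def q_def by (rule zak_term_bound[OF decay b(1) z])
      next
        fix r :: int
        assume r: "0 \<le> r" "r < int n"
        then show "cmod (\<Sum>\<^sub>\<infinity>i. u r i) \<le> \<epsilon>"
          using small[OF t, of "nat r"] by (simp add: u_def zak_def)
      qed
      ultimately show ?thesis by simp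
    qed
    let ?f = "comb b z x\<^sub>0 \<delta> K"
    have f: "?f \<in> L2" "(L2_norm ?f)\<^sup>2 = (2 * real K + 1) * \<delta>"
      using \<delta> b(1) z by (auto intro: comb_in_L2)
    have "A * ((2 * real K + 1) * \<delta>)
        \<le> (\<Sum>\<^sub>\<infinity>i\<in>gabor_lattice \<alpha> (1 / b). (cmod (L2_inner ?f (time_freq_shift g i)))\<^sup>2)"
      using lower[OF f(1)] by (simp add: f(2) b(3))
    also have "\<dots> \<le> b * (W * \<delta>)"
      using lower[OF f(1)] \<delta> window b \<alpha> by (intro comb_frame_sum_le[OF cont]) (auto simp: b(3))
    finally have "(A * (2 * real K + 1)) * \<delta> \<le> (b * W) * \<delta>" by (simp add: mult_ac)
    then have "A * (2 * real K + 1) \<le> b * W" using \<delta>(1) by (simp only: mult_le_cancel_right_pos)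
    also have "b * W = b * (3 * real n * \<epsilon>\<^sup>2) * (2 * real K + 1) + D"
      by (simp add: W_def D_def algebra_simps)
    finally show ?thesis unfolding \<epsilon>(2) by (simp add: algebra_simps)
  qed
  obtain K :: nat where "D / A < real K" using reals_Archimedean2 by blast
  then have "D < A * real K" using A by (simp add: field_simps)
  with bound[of K] A show False by (simp add: algebra_simps)
qed

section \<open>Polynomial multiples of a Gaussian\<close>

text \<open>
  Since \<open>\<bar>x\<bar> ^ j \<le> fact j * exp \<bar>x\<bar>\<close>, it suffices to beat \<open>exp (2 * \<bar>x\<bar>)\<close> by the Gaussian, and completing
  the square gives \<open>2 * \<bar>x\<bar> - a * x\<^sup>2 \<le> 1 / a\<close>.
\<close>

lemma power_gaussian_bound:
  fixes a x :: real
  assumes "0 < a"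
  shows "\<bar>x\<bar> ^ j * exp (- a * x\<^sup>2) \<le> fact j * exp (1 / a) * exp (- \<bar>x\<bar>)"
proof -
  have "\<bar>x\<bar> ^ j \<le> fact j * exp \<bar>x\<bar>"
  proof -
    have "\<bar>x\<bar> ^ j /\<^sub>R fact j \<le> exp \<bar>x\<bar>"
      unfolding exp_def
      using sum_le_suminf[OF summable_exp_generic[of "\<bar>x\<bar>"], of "{j}"] by simp
    then show ?thesis by (simp add: field_simps)
  qed
  moreover have "exp (- a * x\<^sup>2) \<le> exp (1 / a - 2 * \<bar>x\<bar>)"
  proof -
    have "0 \<le> (a * \<bar>x\<bar> - 1)\<^sup>2 / a" using assms by simp
    also have "\<dots> = a * x\<^sup>2 - 2 * \<bar>x\<bar> + 1 / a"
      using assms by (simp add: power2_diff power_mult_distrib field_simps power2_eq_square)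
    finally show ?thesis by simp
  qed
  ultimately have "\<bar>x\<bar> ^ j * exp (- a * x\<^sup>2) \<le> fact j * exp \<bar>x\<bar> * exp (1 / a - 2 * \<bar>x\<bar>)"
    by (rule mult_mono) auto
  also have "\<dots> = fact j * exp (1 / a) * exp (- \<bar>x\<bar>)"
    by (simp flip: exp_add)
  finally show ?thesis .
qed

lemma poly_gaussian_exponential_decay:
  assumes "0 < a"
  obtains M where "\<And>x. cmod (poly_gaussian p a x) \<le> M * exp (- \<bar>x\<bar>)"
proof
  fix x :: real
  have "cmod (poly_gaussian p a x) = cmod (\<Sum>i\<le>degree p. coeff p i * of_real x ^ i) * exp (- a * x\<^sup>2)"
    by (simp add: poly_gaussian_def norm_mult poly_altdef)
  also have "\<dots> \<le> (\<Sum>i\<le>degree p. cmod (coeff p i) * \<bar>x\<bar> ^ i) * exp (- a * x\<^sup>2)"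
    by (intro mult_right_mono order_trans[OF norm_sum] sum_mono) (auto simp: norm_mult norm_power)
  also have "\<dots> = (\<Sum>i\<le>degree p. cmod (coeff p i) * (\<bar>x\<bar> ^ i * exp (- a * x\<^sup>2)))"
    by (simp add: sum_distrib_right mult.assoc)
  also have "\<dots> \<le> (\<Sum>i\<le>degree p. cmod (coeff p i) * (fact i * exp (1 / a) * exp (- \<bar>x\<bar>)))"
    by (intro sum_mono mult_left_mono power_gaussian_bound assms) auto
  also have "\<dots> = (\<Sum>i\<le>degree p. cmod (coeff p i) * (fact i * exp (1 / a))) * exp (- \<bar>x\<bar>)"
    by (simp add: sum_distrib_right mult.assoc)
  finally show "cmod (poly_gaussian p a x)
      \<le> (\<Sum>i\<le>degree p. cmod (coeff p i) * (fact i * exp (1 / a))) * exp (- \<bar>x\<bar>)" .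
qed

lemma continuous_poly_gaussian: "continuous_on UNIV (poly_gaussian p a)"
  unfolding poly_gaussian_def[abs_def] by (intro continuous_intros)

lemma zak_poly_gaussian_sum:
  assumes "0 < a" "0 < b" "cmod z = 1" "finite J"
  shows "zak b z (poly_gaussian (\<Sum>j\<in>J. smult (c j) (P j)) a) x
    = (\<Sum>j\<in>J. zak b z (poly_gaussian (P j) a) x * c j)"
proof -
  have s: "(\<lambda>k::int. z powi k * poly_gaussian p a (x + b * of_int k)) summable_on UNIV" for p
    using poly_gaussian_exponential_decay[OF assms(1)] summable_zak assms(2,3) by metis
  have "z powi k * poly_gaussian (\<Sum>j\<in>J. smult (c j) (P j)) a y
      = (\<Sum>j\<in>J. z powi k * poly_gaussian (P j) a y * c j)" for k y
    by (simp add: poly_gaussian_def poly_sum sum_distrib_left sum_distrib_right mult_ac)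
  moreover have "((\<lambda>k::int. \<Sum>j\<in>J. z powi k * poly_gaussian (P j) a (x + b * of_int k) * c j)
      has_sum (\<Sum>j\<in>J. zak b z (poly_gaussian (P j) a) x * c j)) UNIV"
    using assms(4)
  proof (induction J rule: finite_induct)
    case (insert j J)
    then show ?case
      using has_sum_add[OF has_sum_cmult_left[OF has_sum_infsum[OF s[of "P j"]], of "c j"] insert.IH]
      by (simp add: zak_def)
  qed simp
  ultimately show ?thesis
    unfolding zak_def[of b z "poly_gaussian (\<Sum>j\<in>J. smult (c j) (P j)) a"] by (simp add: infsumI)
qed

text \<open>
  Replacing \<open>k\<close> by \<open>- m - k\<close> maps the nodes \<open>y + b * k\<close> to the negatives of the nodes \<open>x + b * k\<close>.  Only for
  \<open>z = 1\<close> and \<open>z = - 1\<close> is the sequence \<open>z powi k\<close> invariant under the reflection \<open>k \<mapsto> - k\<close>.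
\<close>

lemma zak_reflection:
  assumes z: "z \<in> {1, - 1}" and g: "\<And>x. g (- x) = s * g x" and xy: "x + y = b * of_int m"
  shows "zak b z g y = z powi m * s * zak b z g x"
proof -
  have pz: "z powi (- k) = z powi k" for k :: int using z by (auto simp: power_int_minus simp flip: power_int_inverse)
  have z0: "z \<noteq> 0" using z by auto
  have "zak b z g y = (\<Sum>\<^sub>\<infinity>k. z powi (- m - k) * g (y + b * of_int (- m - k)))"
  proof -
    have "bij (\<lambda>k::int. - m - k)" by (rule bij_betwI[of _ _ _ "\<lambda>k. - m - k"]) auto
    from infsum_reindex_bij_betw[OF this, of "\<lambda>k. z powi k * g (y + b * of_int k)"]
    show ?thesis by (simp add: zak_def)
  qed
  also have "\<dots> = (\<Sum>\<^sub>\<infinity>k. (z powi m * s) * (z powi k * g (x + b * of_int k)))"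
  proof (rule infsum_cong)
    fix k :: int
    have "- m - k = - (m + k)" by simp
    then have "z powi (- m - k) = z powi m * z powi k" using z0
      by (simp only: pz) (simp add: power_int_add)
    moreover have "y + b * of_int (- m - k) = - (x + b * of_int k)" using xy by (simp add: algebra_simps)
    ultimately show "z powi (- m - k) * g (y + b * of_int (- m - k))
        = (z powi m * s) * (z powi k * g (x + b * of_int k))" by (simp only: g mult_ac)
  qed
  also have "\<dots> = z powi m * s * zak b z g x"
    unfolding zak_def by (rule infsum_cmult_right')
  finally show ?thesis .
qed

section \<open>Polynomials of prescribed parity with common Zak zeros\<close>

text \<open>
  Gaussian elimination: an equation that is not identically zero eliminates one unknown, and both numbers
  drop by one.
\<close>

lemma underdetermined_system_solution:
  fixes a :: "'r \<Rightarrow> 'c \<Rightarrow> 'a::field"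
  assumes "finite R" "finite J" "card R < card J"
  shows "\<exists>c. (\<exists>j\<in>J. c j \<noteq> 0) \<and> (\<forall>r\<in>R. (\<Sum>j\<in>J. a r j * c j) = 0)"
  using assms
proof (induction R arbitrary: J a rule: finite_induct)
  case empty
  then obtain j where "j \<in> J" by (metis card.empty card_gt_0_iff ex_in_conv less_irrefl)
  then show ?case by (intro exI[of _ "\<lambda>_. 1"]) auto
next
  case (insert r R)
  show ?case
  proof (cases "\<forall>j\<in>J. a r j = 0")
    case True
    have "card R < card J" using insert by simp
    from insert.IH[OF insert.prems(1) this, of a] True show ?thesis by auto
  next
    case False
    then obtain k where k: "k \<in> J" "a r k \<noteq> 0" by blast
    define J' where "J' = J - {k}"
    have J': "finite J'" "k \<notin> J'" "J = insert k J'" "card R < card J'"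
      using insert k by (auto simp: J'_def card_Diff_singleton)
    obtain c where c: "\<exists>j\<in>J'. c j \<noteq> 0"
        "\<And>r'. r' \<in> R \<Longrightarrow> (\<Sum>j\<in>J'. (a r' j - a r' k * a r j / a r k) * c j) = 0"
      using insert.IH[OF J'(1,4), of "\<lambda>r' j. a r' j - a r' k * a r j / a r k"] by blast
    define s where "s = (\<Sum>j\<in>J'. a r j * c j)"
    define d where "d = c(k := - s / a r k)"
    have sum_d: "(\<Sum>j\<in>J. a r' j * d j) = - (a r' k * s / a r k) + (\<Sum>j\<in>J'. a r' j * c j)" for r'
    proof -
      have "(\<Sum>j\<in>J'. a r' j * d j) = (\<Sum>j\<in>J'. a r' j * c j)"
        using J'(2) by (intro sum.cong) (auto simp: d_def)
      then show ?thesis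
        using J' by (simp add: d_def)
    qed
    have "(\<Sum>j\<in>J. a r' j * d j) = 0" if "r' \<in> R" for r'
    proof -
      have "0 = (\<Sum>j\<in>J'. a r' j * c j) - a r' k / a r k * s"
        unfolding c(2)[OF that, symmetric] s_def sum_distrib_left sum_subtractf[symmetric]
        by (intro sum.cong refl) (simp add: algebra_simps)
      then show ?thesis unfolding sum_d by simp
    qed
    moreover have "(\<Sum>j\<in>J. a r j * d j) = 0"
      unfolding sum_d using k(2) by (simp add: s_def)
    moreover have "\<exists>j\<in>J. d j \<noteq> 0"
      using c(1) J'(2,3) by (auto simp: d_def)
    ultimately show ?thesis by blast
  qed
qed

lemma poly_of_parity:
  fixes c :: "nat \<Rightarrow> complex" and N :: nat
  defines "p \<equiv> \<Sum>j\<in>{..N div 2}. smult (c j) (monom 1 (N - 2 * j))"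
  shows "degree p \<le> N" and "poly p (- x) = (- 1) ^ N * poly p x"
    and "j \<le> N div 2 \<Longrightarrow> c j \<noteq> 0 \<Longrightarrow> p \<noteq> 0"
proof -
  show "degree p \<le> N"
    unfolding p_def by (intro degree_sum_le) (auto simp: degree_monom_eq)
  have "(- x) ^ (N - 2 * j) = (- 1) ^ N * x ^ (N - 2 * j)" if "j \<le> N div 2" for j
  proof -
    have "even (N - 2 * j) = even N" using that by presburger
    then show ?thesis by (cases "even N") auto
  qed
  then show "poly p (- x) = (- 1) ^ N * poly p x"
    by (auto simp: p_def poly_sum poly_monom sum_distrib_left mult_ac intro!: sum.cong)
  assume j: "j \<le> N div 2" "c j \<noteq> 0"
  have "coeff p (N - 2 * j) = (\<Sum>i\<in>{..N div 2}. if i = j then c j else 0)"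
    unfolding p_def coeff_sum using j(1) by (intro sum.cong) (auto simp: coeff_monom)
  then have "coeff p (N - 2 * j) = c j" using j(1) by simp
  with j(2) show "p \<noteq> 0" by auto
qed

text \<open>
  For even \<open>N\<close> the nodes \<open>X r + b * k\<close> are the odd multiples of \<open>\<alpha> / 2\<close>, for odd \<open>N\<close> the even
  multiples.  The sign \<open>z = (- 1) ^ (N + 1)\<close> is opposite to the parity of the polynomial; it is this
  mismatch that makes the self-symmetric condition at \<open>r = 0\<close> automatic.
\<close>

theorem corollary3p7:
  fixes a \<alpha> \<beta> :: real and N :: nat
  assumes "a > 0" and "\<alpha> > 0" and "\<beta> > 0" and "N \<ge> 1"
    and "\<alpha> * \<beta> = 1 / (real N + 1)"
  shows "\<exists>p :: complex poly. p \<noteq> 0 \<and> degree p \<le> N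
           \<and> \<not> gabor_frame (poly_gaussian p a) \<alpha> \<beta>
           \<and> (even N \<longrightarrow> even_poly p) \<and> (odd N \<longrightarrow> odd_poly p)"
proof -
  define b where "b = 1 / \<beta>"
  define z :: complex where "z = (- 1) ^ (N + 1)"
  have b: "0 < b" "b = \<alpha> * (real N + 1)" using assms by (auto simp: b_def field_simps)
  have z: "cmod z = 1" "z \<in> {1, - 1}" by (cases "even N"; simp add: z_def norm_power)+
  define X where "X = (\<lambda>r::nat. b / 2 - \<alpha> * real r)"
  define P where "P = (\<lambda>j. monom (1::complex) (N - 2 * j))"
  obtain c where c: "\<exists>j\<in>{..N div 2}. c j \<noteq> 0"
      "\<forall>r\<in>{1..N div 2}. (\<Sum>j\<in>{..N div 2}. zak b z (poly_gaussian (P j) a) (X r) * c j) = 0"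
    using underdetermined_system_solution[of "{1..N div 2}" "{..N div 2}"
        "\<lambda>r j. zak b z (poly_gaussian (P j) a) (X r)"] by auto
  define p where "p = (\<Sum>j\<in>{..N div 2}. smult (c j) (P j))"
  define g where "g = poly_gaussian p a"
  have p: "p \<noteq> 0" "degree p \<le> N" "poly p (- x) = (- 1) ^ N * poly p x" for x
    using poly_of_parity[where c = c and N = N] c(1) unfolding p_def P_def by blast+
  have parity: "g (- x) = (- 1) ^ N * g x" for x
    by (simp add: g_def poly_gaussian_def p(3))
  have imposed: "zak b z g (X r) = 0" if "r \<in> {1..N div 2}" for r
    unfolding g_def p_def zak_poly_gaussian_sum[OF assms(1) b(1) z(1) finite_atMost]
    using c(2) that by (rule bspec)
  \<comment> \<open>The residue classes \<open>r\<close> and \<open>N + 1 - r\<close> are reflections of each other.\<close>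
  have mirrored: "zak b z g (X (N + 1 - r)) = (- 1) ^ N * zak b z g (X r)" if "r \<le> N" for r
    using zak_reflection[of z g "(- 1) ^ N" "X r" "X (N + 1 - r)" b 0, OF z(2) parity] that
    by (simp add: X_def b(2) of_nat_diff algebra_simps)
  have zeros: "zak b z g (X r) = 0" if r: "r < N + 1" for r
  proof -
    have "r = 0 \<or> (1 \<le> r \<and> r \<le> N div 2) \<or> (odd N \<and> 2 * r = N + 1)
        \<or> (1 \<le> N + 1 - r \<and> N + 1 - r \<le> N div 2)"
      using r by presburger
    then consider "r = 0" | "r \<in> {1..N div 2}" | "odd N" "2 * r = N + 1" | "N + 1 - r \<in> {1..N div 2}"
      by auto
    then show ?thesis
    proof cases
      case 1
      have "zak b z g (X 0) = z powi 1 * (- 1) ^ N * zak b z g (X 0)"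
        by (rule zak_reflection[of z g "(- 1) ^ N" "X 0", OF z(2) parity]) (simp add: X_def)
      then have "zak b z g (X 0) = - zak b z g (X 0)"
        by (simp add: z_def flip: power_add mult_2)
      then show ?thesis using 1 by simp
    next
      case 2
      then show ?thesis by (rule imposed)
    next
      case 3
      then have "N + 1 - r = r" by simp
      then have "zak b z g (X r) = - zak b z g (X r)" using mirrored[of r] 3 r by simp
      then show ?thesis by simp
    next
      case 4
      have "(- 1) ^ N * zak b z g (X r) = 0"
        using mirrored[of r] imposed[OF 4] r by simp
      then show ?thesis by simp
    qed
  qed
  obtain M where M: "\<And>x. cmod (g x) \<le> M * exp (- \<bar>x\<bar>)"
    using poly_gaussian_exponential_decay[OF assms(1)] unfolding g_def by blast
  have "\<not> gabor_frame g \<alpha> \<beta>"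
  proof (rule not_gabor_frame_if_zak_zeros[where n = "N + 1"])
    show "continuous_on UNIV g" unfolding g_def by (rule continuous_poly_gaussian)
    show "zak (1 / \<beta>) z g (b / 2 - \<alpha> * real r) = 0" if "r < N + 1" for r
      using zeros[OF that] by (simp add: X_def b_def)
  qed (use assms z M in \<open>auto simp: add.commute\<close>)
  moreover have "(even N \<longrightarrow> even_poly p) \<and> (odd N \<longrightarrow> odd_poly p)"
    by (simp add: even_poly_def odd_poly_def p(3))
  ultimately show ?thesis using p(1,2) by (auto simp: g_def)
qed

end
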